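(* Let $\hbar>0$ and let $n\geq 1$ be an integer. The projection $p_n = g_n(u+\hbar)W+f_n(u)+g_n(u)W^{-1}\in\mathcal{C}_\hbar^\infty$ (with $f_n,g_n$ as defined in the context) satisfies $\tau(p_n)=n\hbar$.
   Context: Let $\mathcal{S}(\mathbb{R}\times S^1)$ ($S^1=\mathbb{R}/\mathbb{Z}$) be the Schwartz functions on $\mathbb{R}\times S^1$; with $W=e^{2\pi i t}$, each is written $f(u,t)=\sum_{n\in\mathbb{Z}}f_n(u)W^n$ with $f_n\in\mathcal{S}(\mathbb{R})$. The algebra $\mathcal{C}_\hbar^\infty$ is this vector space with the product $fg=\sum_{n}\big[\sum_{k}f_k(u)g_{n-k}(u+k\hbar)\big]W^n$ (so $W^nf(u)=f(u+n\hbar)W^n$) and involution $f^*=\sum_n\overline{f_{-n}(u+n\hbar)}W^n$. The trace is $\tau(f)=\int_{-\infty}^{\infty}f_0(u)\,du$, where $f_0$ is the coefficient of $W^0$. Construction of $p_n$. Let $\phi_0$ be a function increasing smoothly from $0$ to $1$ on $[0,\hbar]$, and define $f,g:\mathbb{R}\to\mathbb{R}$ by: $f(u)=0$ if $u\le 0$ or $u\ge 2\hbar$, $f(u)=\phi_0(u)$ if $0\le u\le\hbar$, $f(u)=1-\phi_0(u-\hbar)$ if $\hbar\le u\le 2\hbar$; $g(u)=0$ if $u\le\hbar$ or $u\ge 2\hbar$, $g(u)=\sqrt{f(u)-f(u)^2}$ if $\hbar\le u\le 2\hbar$. The function $\phi_0$ is assumed chosen so that $f$ and $g$ are smooth on $\mathbb{R}$.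 For $n\ge1$ set $f_n(u)=\sum_{k=1}^nW^{-2k}f(u)W^{2k}=\sum_{k=1}^nf(u-2k\hbar)$ and $g_n(u)=\sum_{k=1}^nW^{-2k}g(u)W^{2k}=\sum_{k=1}^ng(u-2k\hbar)$. *)

theory Defs
  imports "HOL-Analysis.Analysis"
begin

text \<open>
  Functions on \<open>\<real> \<times> S\<^sup>1\<close>, \<open>S\<^sup>1 = \<real>/\<int>\<close>, are represented as curried functions \<open>F u t\<close> on
  \<open>\<real> \<times> \<real>\<close> that are 1-periodic in \<open>t\<close>.
\<close>

definition partial_u :: "(real \<Rightarrow> real \<Rightarrow> complex) \<Rightarrow> real \<Rightarrow> real \<Rightarrow> complex" where
  "partial_u F u t = vector_derivative (\<lambda>x. F x t) (at u)"

definition partial_t :: "(real \<Rightarrow> real \<Rightarrow> complex) \<Rightarrow> real \<Rightarrow> real \<Rightarrow> complex" where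
  "partial_t F u t = vector_derivative (\<lambda>s. F u s) (at t)"

text \<open>
  Requiring every \<open>\<partial>\<^sub>u\<^sup>a \<partial>\<^sub>t\<^sup>b F\<close> to be (Frechet) differentiable amounts to smoothness:
  the mixed partial derivatives then commute, so no other order of differentiation has to be
  considered.
\<close>

definition schwartz_cylinder :: "(real \<Rightarrow> real \<Rightarrow> complex) set" where
  "schwartz_cylinder = {F.
     (\<forall>u t. F u (t + 1) = F u t) \<and>
     (\<forall>a b. case_prod ((partial_u ^^ a) ((partial_t ^^ b) F)) differentiable_on UNIV) \<and>
     (\<forall>m a b. bounded (range (\<lambda>(u, t).
        of_real (u ^ m) * (partial_u ^^ a) ((partial_t ^^ b) F) u t)))}"

definition W :: "real \<Rightarrow> complex" where
  "W t = exp (2 * of_real pi * \<i> * of_real t)"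

definition fourier_coeff :: "(real \<Rightarrow> real \<Rightarrow> complex) \<Rightarrow> int \<Rightarrow> real \<Rightarrow> complex" where
  "fourier_coeff F n u = (LBINT t:{0..1}. F u t * W t powi (- n))"

text \<open>
  The algebra with deformation parameter \<open>h\<close> has \<^const>\<open>schwartz_cylinder\<close> as its underlying
  vector space. For its elements all the sums over \<open>\<int>\<close> below converge absolutely.
\<close>

definition star_prod ::
  "real \<Rightarrow> (real \<Rightarrow> real \<Rightarrow> complex) \<Rightarrow> (real \<Rightarrow> real \<Rightarrow> complex) \<Rightarrow> real \<Rightarrow> real \<Rightarrow> complex" where
  "star_prod h F G u t =
     (\<Sum>\<^sub>\<infinity>n\<in>UNIV. (\<Sum>\<^sub>\<infinity>k\<in>UNIV.
        fourier_coeff F k u * fourier_coeff G (n - k) (u + of_int k * h)) * W t powi n)"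

definition involution :: "real \<Rightarrow> (real \<Rightarrow> real \<Rightarrow> complex) \<Rightarrow> real \<Rightarrow> real \<Rightarrow> complex" where
  "involution h F u t =
     (\<Sum>\<^sub>\<infinity>n\<in>UNIV. cnj (fourier_coeff F (- n) (u + of_int n * h)) * W t powi n)"

definition tau :: "(real \<Rightarrow> real \<Rightarrow> complex) \<Rightarrow> complex" where
  "tau F = (LBINT u. fourier_coeff F 0 u)"

definition is_projection :: "real \<Rightarrow> (real \<Rightarrow> real \<Rightarrow> complex) \<Rightarrow> bool" where
  "is_projection h F \<longleftrightarrow>
     F \<in> schwartz_cylinder \<and> star_prod h F F = F \<and> involution h F = F"

text \<open>Derivatives are relative to \<open>S\<close>, hence one-sided at the endpoints of a closed interval.\<close>

definition smooth_on :: "real set \<Rightarrow> (real \<Rightarrow> real) \<Rightarrow> bool" where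
  "smooth_on S f \<longleftrightarrow> (\<exists>D :: nat \<Rightarrow> real \<Rightarrow> real. (\<forall>x\<in>S. D 0 x = f x) \<and>
     (\<forall>k. \<forall>x\<in>S. (D k has_real_derivative D (Suc k) x) (at x within S)))"

definition bump_f :: "real \<Rightarrow> (real \<Rightarrow> real) \<Rightarrow> real \<Rightarrow> real" where
  "bump_f h \<phi> u =
     (if u \<le> 0 \<or> u \<ge> 2 * h then 0 else if u \<le> h then \<phi> u else 1 - \<phi> (u - h))"

definition bump_g :: "real \<Rightarrow> (real \<Rightarrow> real) \<Rightarrow> real \<Rightarrow> real" where
  "bump_g h \<phi> u =
     (if u \<le> h \<or> u \<ge> 2 * h then 0 else sqrt (bump_f h \<phi> u - (bump_f h \<phi> u)\<^sup>2))"

text \<open>\<open>W\<^sup>-\<^sup>2\<^sup>k f(u) W\<^sup>2\<^sup>k = f(u - 2kh)\<close>, since \<open>W\<^sup>n f(u) = f(u + nh) W\<^sup>n\<close> in the algebra.\<close>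

definition shift_sum :: "real \<Rightarrow> nat \<Rightarrow> (real \<Rightarrow> real) \<Rightarrow> real \<Rightarrow> real" where
  "shift_sum h n f u = (\<Sum>k=1..n. f (u - 2 * real k * h))"

definition proj_p :: "real \<Rightarrow> (real \<Rightarrow> real) \<Rightarrow> nat \<Rightarrow> real \<Rightarrow> real \<Rightarrow> complex" where
  "proj_p h \<phi> n u t =
     of_real (shift_sum h n (bump_g h \<phi>) (u + h)) * W t
     + of_real (shift_sum h n (bump_f h \<phi>) u)
     + of_real (shift_sum h n (bump_g h \<phi>) u) * inverse (W t)"

end

theory Submission
  imports Defs
begin

text \<open>
  With \<open>F = f\<^sub>n\<close>, \<open>G = g\<^sub>n\<close> the Fourier coefficients of \<open>p = p\<^sub>n\<close> are \<open>G(u + h)\<close>, \<open>F(u)\<close>, \<open>G(u)\<close> in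
  degrees \<open>1\<close>, \<open>0\<close>, \<open>-1\<close> and zero otherwise. Comparing coefficients, \<open>p p = p\<close> amounts to
  \<open>G(u) G(u + h) = 0\<close>, \<open>G(u + h) (F(u + h) + F(u)) = G(u + h)\<close> and
  \<open>G(u + h)\<^sup>2 + F(u)\<^sup>2 + G(u)\<^sup>2 = F(u)\<close>. On each period of length \<open>2h\<close> at most one summand of
  \<open>F\<close> and of \<open>G\<close> is nonzero, so these follow from \<open>f(v + h) = 1 - f(v)\<close> and \<open>g\<^sup>2 = f - f\<^sup>2\<close>.
  In the trace, the contributions of \<open>\<phi>\<close> and \<open>-\<phi>\<close> to \<open>\<integral>f\<close> cancel, leaving \<open>h\<close> for each
  of the \<open>n\<close> translates.
\<close>

section \<open>Trigonometric polynomials in \<open>W\<close> and their Fourier coefficients\<close>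

definition trig_poly :: "int set \<Rightarrow> (int \<Rightarrow> real \<Rightarrow> complex) \<Rightarrow> real \<Rightarrow> real \<Rightarrow> complex" where
  "trig_poly J c u t = (\<Sum>j\<in>J. c j u * W t powi j)"

lemma W_powi: "W t powi j = exp (of_int j * (2 * of_real pi * \<i> * of_real t))"
  unfolding W_def by (rule exp_power_int)

lemma W_nonzero [simp]: "W t \<noteq> 0"
  by (simp add: W_def)

lemma norm_W_powi [simp]: "norm (W t powi j) = 1"
  by (simp add: W_powi norm_exp_eq_Re)

lemma W_periodic: "W (t + 1) = W t"
  by (simp add: W_def algebra_simps exp_add exp_two_pi_i')

lemma W_1: "W 1 = 1" and W_0: "W 0 = 1"
  by (simp_all add: W_def exp_two_pi_i')

lemma W_powi_has_vector_derivative: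
  "((\<lambda>t. W t powi j) has_vector_derivative (2 * of_real pi * \<i> * of_int j) * W t powi j)
     (at t within S)"
proof -
  have "((\<lambda>z. exp (of_int j * (2 * of_real pi * \<i> * z))) has_field_derivative
      (2 * of_real pi * \<i> * of_int j) * exp (of_int j * (2 * of_real pi * \<i> * of_real t)))
      (at (of_real t))"
    by (auto intro!: derivative_eq_intros)
  then show ?thesis
    unfolding W_powi using has_vector_derivative_real_field by blast
qed

lemma continuous_W_powi: "continuous_on S (\<lambda>t. W t powi j)"
  unfolding W_powi by (intro continuous_intros)

lemma W_powi_set_integrable: "set_integrable lborel {0..1} (\<lambda>t. W t powi j)"
  by (intro borel_integrable_atLeastAtMost' continuous_W_powi)

text \<open>Orthogonality of characters: for nonzero \<open>j\<close> the primitive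
  \<open>W t powi j / (2 pi i j)\<close> takes the same value at both ends of the period.\<close>

lemma integral_W_powi: "(LBINT t:{0..1}. W t powi j) = (if j = 0 then 1 else 0)"
proof (cases "j = 0")
  case True
  then show ?thesis by (simp add: set_lebesgue_integral_def)
next
  case False
  let ?c = "2 * of_real pi * \<i> * of_int j :: complex"
  have c: "?c \<noteq> 0" using False by simp
  have "((\<lambda>t. W t powi j / ?c) has_vector_derivative W t powi j) (at t within {0..1})" for t
    using has_vector_derivative_divide[OF W_powi_has_vector_derivative[of j t "{0..1}"], of ?c] c
    by simp
  then have "(LBINT t:{0..1}. W t powi j) = W 1 powi j / ?c - W 0 powi j / ?c"
    unfolding set_lebesgue_integral_def
    by (intro integral_FTC_atLeastAtMost continuous_W_powi) auto
  then show ?thesis using False by (simp add: W_1 W_0)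
qed

lemma fourier_coeff_trig_poly:
  assumes "finite J"
  shows "fourier_coeff (trig_poly J c) m u = (if m \<in> J then c m u else 0)"
proof -
  have "trig_poly J c u t * W t powi (- m) = (\<Sum>j\<in>J. c j u * W t powi (j - m))" for t
    by (simp add: trig_poly_def sum_distrib_right mult.assoc flip: power_int_add)
  then have "fourier_coeff (trig_poly J c) m u =
      (\<Sum>j\<in>J. LBINT t:{0..1}. c j u * W t powi (j - m))"
    using W_powi_set_integrable
    by (simp add: fourier_coeff_def set_lebesgue_integral_def set_integrable_def
        scaleR_sum_right mult_scaleR_right[symmetric] del: mult_scaleR_right)
  also have "\<dots> = (\<Sum>j\<in>J. if m = j then c j u else 0)"
    by (intro sum.cong) (auto simp: integral_W_powi)
  finally show ?thesis using assms by simp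
qed

section \<open>Product and involution on trigonometric polynomials\<close>

lemma infsum_finite_support:
  assumes "finite J" "\<And>x. x \<notin> J \<Longrightarrow> f x = 0"
  shows "infsum f UNIV = sum f J"
proof -
  have "infsum f UNIV = infsum f J"
    using assms by (intro infsum_cong_neutral) auto
  with assms show ?thesis by simp
qed

text \<open>Reduces idempotency to a finite identity between coefficients. The test
  \<open>n - k \<in> J\<close> is needed because \<open>c\<close> may take arbitrary values at
  degrees outside \<open>J\<close>, which are not Fourier coefficients.\<close>

lemma star_prod_trig_poly:
  assumes "finite J"
    and "\<And>n u. (\<Sum>k\<in>J. c k u * (if n - k \<in> J then c (n - k) (u + of_int k * h) else 0))
           = (if n \<in> J then c n u else 0)"
  shows "star_prod h (trig_poly J c) (trig_poly J c) = trig_poly J c"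
proof (intro ext)
  fix u t
  have "(\<Sum>\<^sub>\<infinity>k. fourier_coeff (trig_poly J c) k u
          * fourier_coeff (trig_poly J c) (n - k) (u + of_int k * h))
        = (if n \<in> J then c n u else 0)" for n
    unfolding assms(2)[where n = n and u = u, symmetric] fourier_coeff_trig_poly[OF assms(1)]
    by (subst infsum_finite_support[OF assms(1)]) (simp_all cong: sum.cong)
  then have "star_prod h (trig_poly J c) (trig_poly J c) u t =
      (\<Sum>\<^sub>\<infinity>n. (if n \<in> J then c n u else 0) * W t powi n)"
    by (simp add: star_prod_def)
  also have "\<dots> = trig_poly J c u t"
    using assms(1) by (subst infsum_finite_support[where J = J]) (auto simp: trig_poly_def)
  finally show "star_prod h (trig_poly J c) (trig_poly J c) u t = trig_poly J c u t" .
qed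

lemma involution_trig_poly:
  assumes "finite J"
    and "\<And>n. n \<in> J \<longleftrightarrow> - n \<in> J"
    and "\<And>n u. n \<in> J \<Longrightarrow> cnj (c (- n) (u + of_int n * h)) = c n u"
  shows "involution h (trig_poly J c) = trig_poly J c"
proof (intro ext)
  fix u t
  have "involution h (trig_poly J c) u t =
      (\<Sum>\<^sub>\<infinity>n. (if n \<in> J then c n u else 0) * W t powi n)"
    unfolding involution_def fourier_coeff_trig_poly[OF assms(1)]
    using assms(2,3) by (intro infsum_cong) auto
  also have "\<dots> = trig_poly J c u t"
    using assms(1) by (subst infsum_finite_support[where J = J]) (auto simp: trig_poly_def)
  finally show "involution h (trig_poly J c) u t = trig_poly J c u t" .
qed

section \<open>Derivatives of trigonometric polynomials and the Schwartz condition\<close>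

lemma partial_t_trig_poly:
  "partial_t (trig_poly J c) = trig_poly J (\<lambda>j u. (2 * of_real pi * \<i> * of_int j) * c j u)"
proof (intro ext)
  fix u t
  have "((\<lambda>s. trig_poly J c u s) has_vector_derivative
      (\<Sum>j\<in>J. c j u * ((2 * of_real pi * \<i> * of_int j) * W t powi j))) (at t)"
    unfolding trig_poly_def
    by (intro has_vector_derivative_sum has_vector_derivative_mult_right
        W_powi_has_vector_derivative)
  then show "partial_t (trig_poly J c) u t =
      trig_poly J (\<lambda>j u. (2 * of_real pi * \<i> * of_int j) * c j u) u t"
    unfolding partial_t_def trig_poly_def
    by (subst vector_derivative_at) (auto simp: algebra_simps intro!: sum.cong)
qed

lemma partial_u_trig_poly:
  assumes "\<And>j u. j \<in> J \<Longrightarrow> (c j has_vector_derivative c' j u) (at u)"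
  shows "partial_u (trig_poly J c) = trig_poly J c'"
proof (intro ext)
  fix u t
  have "((\<lambda>x. trig_poly J c x t) has_vector_derivative trig_poly J c' u t) (at u)"
    unfolding trig_poly_def
    by (intro has_vector_derivative_sum has_vector_derivative_mult_left assms)
  then show "partial_u (trig_poly J c) u t = trig_poly J c' u t"
    unfolding partial_u_def by (rule vector_derivative_at)
qed

text \<open>\<open>D j k\<close> serves as the \<open>k\<close>-th derivative of the coefficient in
  degree \<open>j\<close>. Each \<open>partial_t\<close> multiplies by \<open>2 pi i j\<close>, each
  \<open>partial_u\<close> advances \<open>k\<close> by one.\<close>

lemma iterated_partials_trig_poly:
  assumes "\<And>j k u. j \<in> J \<Longrightarrow> (D j k has_vector_derivative D j (Suc k) u) (at u)"
  shows "(partial_u ^^ a) ((partial_t ^^ b) (trig_poly J (\<lambda>j. D j 0))) =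
    trig_poly J (\<lambda>j u. (2 * of_real pi * \<i> * of_int j) ^ b * D j a u)"
proof (induction a)
  case 0
  show ?case
    by (induction b) (simp_all add: partial_t_trig_poly mult.assoc)
next
  case (Suc a)
  show ?case
    unfolding funpow.simps o_def Suc
    by (intro partial_u_trig_poly has_vector_derivative_mult_right assms)
qed

text \<open>The complement of the interval is open, so a derivative that vanishes there is locally
  constant, and the next one vanishes too.\<close>

lemma derivatives_vanish_outside:
  fixes D :: "nat \<Rightarrow> real \<Rightarrow> 'a::real_normed_vector"
  assumes "\<And>k u. (D k has_vector_derivative D (Suc k) u) (at u)"
    and "\<And>u. u \<notin> {A..B} \<Longrightarrow> D 0 u = 0"
    and "u \<notin> {A..B}"
  shows "D k u = 0"
  using assms(3)
proof (induction k arbitrary: u)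
  case 0
  then show ?case by (rule assms(2))
next
  case (Suc k)
  have "((\<lambda>_. 0) has_vector_derivative D (Suc k) u) (at u)"
    by (rule has_vector_derivative_transform_within_open[OF assms(1), where S = "- {A..B}"])
      (use Suc in auto)
  then show ?case
    using vector_derivative_unique_at has_vector_derivative_const by blast
qed

text \<open>Compact support replaces decay estimates: a continuous function is bounded on
  \<open>{A..B}\<close> whatever power of \<open>u\<close> it is multiplied by, and outside all
  derivatives are zero.\<close>

lemma trig_poly_schwartz:
  assumes J: "finite J"
    and D: "\<And>j k u. j \<in> J \<Longrightarrow> (D j k has_vector_derivative D j (Suc k) u) (at u)"
    and supp: "\<And>j u. j \<in> J \<Longrightarrow> u \<notin> {A..B} \<Longrightarrow> D j 0 u = 0"
  shows "trig_poly J (\<lambda>j. D j 0) \<in> schwartz_cylinder"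
proof -
  let ?e = "\<lambda>(j::int) (b::nat). (2 * of_real pi * \<i> * of_int j) ^ b :: complex"
  have "case_prod (trig_poly J (\<lambda>j u. ?e j b * D j a u)) differentiable at z" for a b z
  proof -
    \<comment> \<open>Joint differentiability: every term is a function of \<open>fst z\<close>
      times a function of \<open>snd z\<close>.\<close>
    have D': "(\<lambda>z. D j a (fst z)) differentiable at z" if "j \<in> J" for j
      using D[OF that, of a "fst z"]
      by (intro differentiable_compose[of "D j a" fst])
        (auto simp: has_vector_derivative_def differentiable_def
          intro!: derivative_eq_intros)
    have W': "(\<lambda>z::real \<times> real. W (snd z) powi j) differentiable at z" for j
      using W_powi_has_vector_derivative[of j "snd z"]
      by (intro differentiable_compose[of "\<lambda>t. W t powi j" snd])
        (auto simp: has_vector_derivative_def differentiable_def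
          intro!: derivative_eq_intros)
    show ?thesis
      unfolding trig_poly_def case_prod_beta'
      using J D' W' by (intro differentiable_sum differentiable_mult differentiable_const) auto
  qed
  moreover have "bounded (range (\<lambda>(u, t).
      of_real (u ^ m) * trig_poly J (\<lambda>j u. ?e j b * D j a u) u t))" for m a b
  proof -
    have "\<exists>K. \<forall>u. norm (of_real (u ^ m) * (?e j b * D j a u)) \<le> K" if j: "j \<in> J" for j
    proof -
      let ?q = "\<lambda>u::real. of_real (u ^ m) * (?e j b * D j a u)"
      have "continuous_on {A..B} (D j a)"
        using D[OF j] has_vector_derivative_continuous
        by (intro continuous_at_imp_continuous_on) blast
      then have "bounded (?q ` {A..B})"
        by (intro compact_imp_bounded compact_continuous_image continuous_intros) auto
      then obtain K where K: "\<And>u. u \<in> {A..B} \<Longrightarrow> norm (?q u) \<le> K"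
        unfolding bounded_iff by blast
      \<comment> \<open>The \<open>0\<close> covers the points outside \<open>{A..B}\<close>; if
        that interval is empty, \<open>K\<close> could be negative.\<close>
      have "norm (?q u) \<le> max K 0" for u
        using K[of u] derivatives_vanish_outside[of "D j", OF D[OF j] supp[OF j], where u = u and k = a]
        by (cases "u \<in> {A..B}") (auto simp: le_max_iff_disj)
      then show ?thesis by blast
    qed
    then obtain K where
      K: "\<And>j u. j \<in> J \<Longrightarrow> norm (of_real (u ^ m) * (?e j b * D j a u)) \<le> K j"
      by metis
    have "norm (of_real (u ^ m) * trig_poly J (\<lambda>j u. ?e j b * D j a u) u t) \<le> sum K J" for u t
    proof -
      have "of_real (u ^ m) * trig_poly J (\<lambda>j u. ?e j b * D j a u) u t =
          (\<Sum>j\<in>J. (of_real (u ^ m) * (?e j b * D j a u)) * W t powi j)"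
        by (simp add: trig_poly_def sum_distrib_left mult.assoc)
      also have "norm \<dots> \<le> (\<Sum>j\<in>J. K j)"
        using K by (intro sum_norm_le) (simp add: norm_mult)
      finally show ?thesis .
    qed
    then show ?thesis
      by (auto simp: bounded_iff)
  qed
  moreover have "(partial_u ^^ a) ((partial_t ^^ b) (trig_poly J (\<lambda>j. D j 0))) =
      trig_poly J (\<lambda>j u. ?e j b * D j a u)" for a b
    using D by (rule iterated_partials_trig_poly)
  moreover have "trig_poly J (\<lambda>j. D j 0) u (t + 1) = trig_poly J (\<lambda>j. D j 0) u t" for u t
    by (simp add: trig_poly_def W_periodic)
  ultimately show ?thesis
    unfolding schwartz_cylinder_def
    by (simp add: differentiable_on_def differentiable_at_withinI)
qed

section \<open>Closure properties of smoothness\<close>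

lemma smooth_on_imp_continuous_on:
  assumes "smooth_on S f"
  shows "continuous_on S f"
proof -
  obtain D where D: "\<And>x. x \<in> S \<Longrightarrow> D 0 x = f x"
    "\<And>k x. x \<in> S \<Longrightarrow> (D k has_real_derivative D (Suc k) x) (at x within S)"
    using assms unfolding smooth_on_def by blast
  have "continuous_on S (D 0)"
    using D(2) by (intro DERIV_continuous_on) blast
  then show ?thesis using D(1) by (metis continuous_on_cong)
qed

lemma smooth_on_UNIV_shift:
  assumes "smooth_on UNIV f"
  shows "smooth_on UNIV (\<lambda>x. f (x + a))"
proof -
  obtain D where D: "D 0 = f"
    "\<And>k x. (D k has_real_derivative D (Suc k) x) (at x)"
    using assms unfolding smooth_on_def by (auto simp: fun_eq_iff)
  then show ?thesis
    unfolding smooth_on_def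
    by (intro exI[of _ "\<lambda>k x. D k (x + a)"]) (simp flip: DERIV_shift)
qed

lemma smooth_on_sum:
  assumes "\<And>i. i \<in> I \<Longrightarrow> smooth_on S (f i)"
  shows "smooth_on S (\<lambda>x. \<Sum>i\<in>I. f i x)"
proof -
  obtain D where "\<And>i. i \<in> I \<Longrightarrow> (\<forall>x\<in>S. D i 0 x = f i x) \<and>
     (\<forall>k. \<forall>x\<in>S. (D i k has_real_derivative D i (Suc k) x) (at x within S))"
    using assms unfolding smooth_on_def by metis
  then show ?thesis
    unfolding smooth_on_def
    by (intro exI[of _ "\<lambda>k x. \<Sum>i\<in>I. D i k x"]) (auto intro!: DERIV_sum sum.cong)
qed

section \<open>Sums of translates\<close>

lemma smooth_on_shift_sum:
  assumes "smooth_on UNIV f"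
  shows "smooth_on UNIV (shift_sum h n f)"
  unfolding shift_sum_def[abs_def] diff_conv_add_uminus
  by (intro smooth_on_sum smooth_on_UNIV_shift assms)

lemma shift_sum_vanishes:
  assumes "h > 0" and "\<And>v. v \<notin> {0<..<2 * h} \<Longrightarrow> f v = 0"
    and "u \<notin> {0..2 * (real n + 1) * h}"
  shows "shift_sum h n f u = 0"
  unfolding shift_sum_def
proof (intro sum.neutral ballI assms(2))
  fix k assume k: "k \<in> {1..n}"
  show "u - 2 * real k * h \<notin> {0<..<2 * h}"
  proof
    assume "u - 2 * real k * h \<in> {0<..<2 * h}"
    moreover have "2 * real k * h \<ge> 0" "2 * real k * h \<le> 2 * real n * h"
      using k assms(1) by auto
    ultimately have "0 \<le> u" "u \<le> 2 * real n * h + 2 * h"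
      unfolding greaterThanLessThan_iff by linarith+
    then show False using assms(3) by (simp add: algebra_simps)
  qed
qed

lemma shift_sum_eq:
  assumes h: "h > 0" and supp: "\<And>v. v \<notin> {0<..<2 * h} \<Longrightarrow> f v = 0"
    and v: "0 \<le> v" "v \<le> 2 * h"
  shows "shift_sum h n f (v + 2 * of_int m * h) = (if 1 \<le> m \<and> m \<le> int n then f v else 0)"
proof -
  have "f (v + 2 * of_int m * h - 2 * real k * h) = (if m = int k then f v else 0)" for k
  proof (cases "m = int k")
    case False
    \<comment> \<open>A different index moves the argument by at least a full period, to a point
      \<open>\<le> 0\<close> or \<open>\<ge> 2 * h\<close>.\<close>
    define d where "d = m - int k"
    have eq: "v + 2 * of_int m * h - 2 * real k * h = v + 2 * of_int d * h"
      by (simp add: d_def algebra_simps)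
    have "d \<ge> 1 \<or> d \<le> -1" using False by (auto simp: d_def)
    then have "real_of_int d * h \<ge> 1 * h \<or> real_of_int d * h \<le> (-1) * h"
      using h by (intro disj_forward[OF _ mult_right_mono mult_right_mono]) auto
    then show ?thesis
      unfolding eq using v False by (subst supp) auto
  qed simp
  then have "shift_sum h n f (v + 2 * of_int m * h) =
      (\<Sum>k=1..n. if m = int k then f v else 0)"
    by (simp add: shift_sum_def)
  also have "\<dots> = (if 1 \<le> m \<and> m \<le> int n then f v else 0)"
  proof (cases "1 \<le> m \<and> m \<le> int n")
    case True
    then have "(\<Sum>k=1..n. if m = int k then f v else 0) =
        (\<Sum>k=1..n. if k = nat m then f v else 0)"
      by (intro sum.cong) auto
    with True show ?thesis by auto
  qed (auto intro!: sum.neutral)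
  finally show ?thesis .
qed

lemma integral_shift_sum:
  fixes f :: "real \<Rightarrow> real"
  assumes "integrable lborel f"
  shows "(LBINT u. shift_sum h n f u) = real n * (LBINT u. f u)"
proof -
  have "integrable lborel (\<lambda>u. f (u - a))" "(LBINT u. f (u - a)) = (LBINT u. f u)" for a
    using lborel_integrable_real_affine[OF assms, of 1 "-a"]
      lborel_integral_real_affine[of 1 f "-a"]
    by (simp_all add: algebra_simps)
  then show ?thesis
    by (simp add: shift_sum_def)
qed

section \<open>The functions \<open>f\<close> and \<open>g\<close> and the identities behind the
  projection\<close>

context
  fixes h :: real and \<phi> :: "real \<Rightarrow> real"
  assumes h: "h > 0" and mono: "mono_on {0..h} \<phi>" and \<phi>0: "\<phi> 0 = 0" and \<phi>h: "\<phi> h = 1"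
begin

lemma bump_f_supp: "v \<notin> {0<..<2 * h} \<Longrightarrow> bump_f h \<phi> v = 0"
  by (auto simp: bump_f_def)

lemma bump_g_supp: "v \<notin> {0<..<2 * h} \<Longrightarrow> bump_g h \<phi> v = 0"
  using h by (auto simp: bump_g_def)

lemma bump_g_zero: "v \<le> h \<Longrightarrow> bump_g h \<phi> v = 0"
  by (simp add: bump_g_def)

lemma \<phi>_bounds: "0 \<le> v \<Longrightarrow> v \<le> h \<Longrightarrow> 0 \<le> \<phi> v \<and> \<phi> v \<le> 1"
  using mono_onD[OF mono, of 0 v] mono_onD[OF mono, of v h] \<phi>0 \<phi>h by auto

lemma bump_f_bounds: "0 \<le> bump_f h \<phi> v \<and> bump_f h \<phi> v \<le> 1"
  using \<phi>_bounds[of v] \<phi>_bounds[of "v - h"] by (auto simp: bump_f_def)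

lemma bump_f_add: "0 < v \<Longrightarrow> v \<le> h \<Longrightarrow> bump_f h \<phi> (v + h) = 1 - bump_f h \<phi> v"
  using \<phi>h by (auto simp: bump_f_def)

text \<open>As \<open>f\<close> has values between 0 and 1, the radicand \<open>f - f^2\<close> is
  nonnegative. At \<open>v = h\<close> both sides are 0 because \<open>\<phi> h = 1\<close>.\<close>

lemma bump_g_square:
  assumes "h \<le> v"
  shows "(bump_g h \<phi> v)\<^sup>2 = bump_f h \<phi> v - (bump_f h \<phi> v)\<^sup>2"
proof -
  have "(bump_f h \<phi> v)\<^sup>2 \<le> bump_f h \<phi> v"
    using bump_f_bounds[of v] by (simp add: power2_eq_square mult_left_le)
  then show ?thesis
    using assms \<phi>h h by (auto simp: bump_g_def bump_f_def)
qed

text \<open>Splits each period of length \<open>2 * h\<close> into the half where \<open>f\<close>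
  rises and \<open>g\<close> vanishes, and the half where \<open>f\<close> falls. Adding
  \<open>h\<close> to \<open>u\<close> passes from one kind of half to the other.\<close>

lemma period_cases:
  obtains (left) v m where "0 \<le> v" "v \<le> h" "u = v + 2 * of_int m * h"
  | (right) v m where "0 \<le> v" "v \<le> h" "u = v + h + 2 * of_int m * h"
proof -
  define m where "m = \<lfloor>u / (2 * h)\<rfloor>"
  define v where "v = u - 2 * of_int m * h"
  have "of_int m \<le> u / (2 * h)" "u / (2 * h) < of_int m + 1"
    unfolding m_def by linarith+
  then have "0 \<le> v" "v \<le> 2 * h"
    using h by (auto simp: v_def field_simps)
  moreover have "u = v + 2 * of_int m * h" "u = (v - h) + h + 2 * of_int m * h"
    by (simp_all add: v_def)
  ultimately show thesis
    using left[of v m] right[of "v - h" m] by (cases "v \<le> h") simp_all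
qed

lemma projection_identities:
  fixes u :: real and n :: nat
  defines "F \<equiv> shift_sum h n (bump_f h \<phi>)" and "G \<equiv> shift_sum h n (bump_g h \<phi>)"
  shows "G u * G (u + h) = 0"
    and "G (u + h) * (F (u + h) + F u) = G (u + h)"
    and "(G (u + h))\<^sup>2 + (F u)\<^sup>2 + (G u)\<^sup>2 = F u"
proof -
  have F: "F (v + 2 * of_int m * h) = (if 1 \<le> m \<and> m \<le> int n then bump_f h \<phi> v else 0)"
    and G: "G (v + 2 * of_int m * h) = (if 1 \<le> m \<and> m \<le> int n then bump_g h \<phi> v else 0)"
    if "0 \<le> v" "v \<le> 2 * h" for v m
    unfolding F_def G_def
    using that h bump_f_supp bump_g_supp by (intro shift_sum_eq; simp)+
  have "G u * G (u + h) = 0 \<and> G (u + h) * (F (u + h) + F u) = G (u + h) \<and>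
    (G (u + h))\<^sup>2 + (F u)\<^sup>2 + (G u)\<^sup>2 = F u"
  proof (cases u rule: period_cases)
    case (left v m)
    have uh: "u + h = (v + h) + 2 * of_int m * h"
      using left by simp
    have "F u = (if 1 \<le> m \<and> m \<le> int n then bump_f h \<phi> v else 0)" "G u = 0"
      "F (u + h) = (if 1 \<le> m \<and> m \<le> int n then bump_f h \<phi> (v + h) else 0)"
      "G (u + h) = (if 1 \<le> m \<and> m \<le> int n then bump_g h \<phi> (v + h) else 0)"
      using left F[of v m] G[of v m] F[of "v + h" m] G[of "v + h" m] h bump_g_zero[of v]
      unfolding uh by auto
    \<comment> \<open>The point \<open>v = 0\<close> is treated apart because
      \<open>bump_f_add\<close> is stated for \<open>0 < v\<close>.\<close>
    moreover have "bump_g h \<phi> (v + h) = 0 \<and> bump_f h \<phi> v = 0" if "v = 0"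
      using that bump_g_zero[of h] bump_f_supp[of 0] by simp
    \<comment> \<open>The expression \<open>x - x^2\<close> is unchanged under \<open>x\<close> to
      \<open>1 - x\<close>, so \<open>g(v + h)^2\<close> can be expressed through
      \<open>f(v)\<close>.\<close>
    moreover have "bump_f h \<phi> (v + h) = 1 - bump_f h \<phi> v"
      "(bump_g h \<phi> (v + h))\<^sup>2 = bump_f h \<phi> v - (bump_f h \<phi> v)\<^sup>2" if "v \<noteq> 0"
      using that bump_f_add[of v] bump_g_square[of "v + h"] left
      by (simp_all add: power2_diff)
    ultimately show ?thesis
      by (cases "v = 0") auto
  next
    case (right v m)
    \<comment> \<open>Here \<open>u + h\<close> lies in the first half of the next period, so
      \<open>G (u + h)\<close> vanishes whether or not \<open>m + 1\<close> is in range.\<close>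
    have uh: "u + h = v + 2 * of_int (m + 1) * h"
      using right by (simp add: algebra_simps)
    have "F u = (if 1 \<le> m \<and> m \<le> int n then bump_f h \<phi> (v + h) else 0)" "G (u + h) = 0"
      "G u = (if 1 \<le> m \<and> m \<le> int n then bump_g h \<phi> (v + h) else 0)"
      using right F[of "v + h" m] G[of "v + h" m] G[of v "m + 1"] h bump_g_zero[of v]
      unfolding uh by auto
    then show ?thesis
      using bump_g_square[of "v + h"] right by auto
  qed
  then show "G u * G (u + h) = 0" "G (u + h) * (F (u + h) + F u) = G (u + h)"
    "(G (u + h))\<^sup>2 + (F u)\<^sup>2 + (G u)\<^sup>2 = F u" by blast+
qed

lemma bump_f_integral:
  assumes "continuous_on {0..h} \<phi>"
  shows "integrable lborel (bump_f h \<phi>)" "(LBINT u. bump_f h \<phi> u) = h"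
proof -
  define q where "q u = indicator {0..h} u * \<phi> u" for u
  have q: "integrable lborel q"
    using borel_integrable_atLeastAtMost'[OF assms]
    by (simp add: q_def[abs_def] set_integrable_def)
  have q': "integrable lborel (\<lambda>u. q (u - h))" "(LBINT u. q (u - h)) = (LBINT u. q u)"
    using lborel_integrable_real_affine[OF q, of 1 "-h"]
      lborel_integral_real_affine[of 1 q "-h"]
    by (simp_all add: algebra_simps)
  have i: "integrable lborel (indicator {h<..2 * h} :: real \<Rightarrow> real)"
    using h by (simp add: integrable_indicator_iff)
  \<comment> \<open>The falling half is \<open>1 - \<phi>(u - h)\<close>. The half-open interval
    avoids counting \<open>u = h\<close> twice: there \<open>q h = 1\<close> and
    \<open>q 0 = 0\<close>.\<close>
  have eq: "bump_f h \<phi> = (\<lambda>u. q u + (indicator {h<..2 * h} u - q (u - h)))"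
    using h \<phi>0 \<phi>h by (auto simp: fun_eq_iff bump_f_def q_def indicator_def)
  show "integrable lborel (bump_f h \<phi>)"
    unfolding eq using q q' i by (intro Bochner_Integration.integrable_add Bochner_Integration.integrable_diff)
  show "(LBINT u. bump_f h \<phi> u) = h"
    unfolding eq using q q' i h by simp
qed

end

section \<open>The projection as a trigonometric polynomial, and its trace\<close>

lemma proj_p_eq_trig_poly:
  "proj_p h \<phi> n = trig_poly {-1, 0, 1} (\<lambda>j u. of_real (
     if j = 0 then shift_sum h n (bump_f h \<phi>) u
     else if j = 1 then shift_sum h n (bump_g h \<phi>) (u + h)
     else shift_sum h n (bump_g h \<phi>) u))"
  by (auto simp: fun_eq_iff proj_p_def trig_poly_def power_int_minus)

theorem proposition3p2:
  fixes h :: real and n :: nat and \<phi> :: "real \<Rightarrow> real"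
  assumes "h > 0" and "n \<ge> 1"
    and "smooth_on {0..h} \<phi>" and "mono_on {0..h} \<phi>" and "\<phi> 0 = 0" and "\<phi> h = 1"
    and "smooth_on UNIV (bump_f h \<phi>)" and "smooth_on UNIV (bump_g h \<phi>)"
  shows "is_projection h (proj_p h \<phi> n) \<and> tau (proj_p h \<phi> n) = of_real (real n * h)"
proof -
  define F where "F = shift_sum h n (bump_f h \<phi>)"
  define G where "G = shift_sum h n (bump_g h \<phi>)"
  \<comment> \<open>The coefficients are kept real so that the identities can be checked over the
    reals. Within \<open>J\<close> the last case means \<open>j = -1\<close>.\<close>
  define c where "c j u = (if j = 0 then F u else if j = 1 then G (u + h) else G u)"
    for j :: int and u
  define J where "J = {-1, 0, 1 :: int}"
  have J: "finite J" by (simp add: J_def)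
  have p: "proj_p h \<phi> n = trig_poly J (\<lambda>j u. of_real (c j u))"
    unfolding proj_p_eq_trig_poly c_def J_def F_def G_def ..
  note ids = projection_identities[OF assms(1,4-6), of n, folded F_def G_def]

  have "proj_p h \<phi> n \<in> schwartz_cylinder"
  proof -
    have smooth: "smooth_on UNIV F" "smooth_on UNIV G" "smooth_on UNIV (\<lambda>u. G (u + h))"
      unfolding F_def G_def by (intro smooth_on_UNIV_shift smooth_on_shift_sum assms)+
    have "smooth_on UNIV (c j)" for j
      using smooth by (cases "j = 0"; cases "j = 1") (simp_all add: c_def[abs_def])
    then obtain D where D0: "\<And>j. D j 0 = c j"
      and D: "\<And>j k x. (D j k has_real_derivative D j (Suc k) x) (at x)"
      unfolding smooth_on_def fun_eq_iff by simp metis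
    have supp: "F u = 0" "G u = 0" if "u \<notin> {0..2 * (real n + 1) * h}" for u
      unfolding F_def G_def
      using that bump_f_supp[OF assms(1,4-6)] bump_g_supp[OF assms(1,4-6)] assms(1)
      by (intro shift_sum_vanishes; simp)+
    have "trig_poly J (\<lambda>j. (\<lambda>k u. complex_of_real (D j k u)) 0) \<in> schwartz_cylinder"
    proof (rule trig_poly_schwartz[OF J])
      show "((\<lambda>u. complex_of_real (D j k u)) has_vector_derivative
          complex_of_real (D j (Suc k) u)) (at u)" for j k u
        using D[of j k u] has_vector_derivative_of_real
        by (simp add: has_real_derivative_iff_has_vector_derivative)
      \<comment> \<open>The left end is \<open>-h\<close> because the coefficient
        \<open>G (u + h)\<close> is shifted left by \<open>h\<close>.\<close>
      show "complex_of_real (D j 0 u) = 0" if "u \<notin> {-h..2 * (real n + 1) * h}" for j u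
        using that supp[of u] supp[of "u + h"] assms(1) by (auto simp: D0 c_def)
    qed
    then show ?thesis by (simp add: p D0)
  qed
  moreover have "star_prod h (proj_p h \<phi> n) (proj_p h \<phi> n) = proj_p h \<phi> n"
    unfolding p
  proof (rule star_prod_trig_poly[OF J])
    fix m u
    have 1: "(\<Sum>k\<in>J. c k u * (if m - k \<in> J then c (m - k) (u + of_int k * h) else 0))
        = (if m \<in> J then c m u else 0)"
    proof -
      \<comment> \<open>Products of degrees in \<open>J\<close> reach from -2 to 2. Degrees 0 and 1
        use the identities at \<open>u\<close>, degree 2 those at \<open>u + h\<close>, and the
        negative degrees those at \<open>u - h\<close>.\<close>
      consider "m = -2" | "m = -1" | "m = 0" | "m = 1" | "m = 2" | "m < -2 \<or> m > 2" by linarith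
      then show ?thesis
        using ids[of u] ids[of "u + h"] ids[of "u - h"]
        by cases (auto simp: J_def c_def power2_eq_square algebra_simps)
    qed
    show "(\<Sum>k\<in>J. complex_of_real (c k u) *
            (if m - k \<in> J then of_real (c (m - k) (u + of_int k * h)) else 0))
        = (if m \<in> J then of_real (c m u) else 0)"
      using arg_cong[OF 1, of complex_of_real]
      by (simp add: if_distrib[of complex_of_real] cong: if_cong)
  qed
  moreover have "involution h (proj_p h \<phi> n) = proj_p h \<phi> n"
    \<comment> \<open>Self-adjointness holds since all coefficients are real and the one in degree 1
      is the one in degree -1 evaluated at \<open>u + h\<close>.\<close>
    unfolding p by (rule involution_trig_poly[OF J]) (auto simp: J_def c_def)
  moreover have "tau (proj_p h \<phi> n) = of_real (real n * h)"
  proof -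
    note int = bump_f_integral[OF assms(1,4-6) smooth_on_imp_continuous_on[OF assms(3)]]
    have "tau (proj_p h \<phi> n) = (LBINT u. complex_of_real (F u))"
      by (simp add: tau_def p fourier_coeff_trig_poly[OF J]) (simp add: J_def c_def)
    also have "\<dots> = of_real (LBINT u. F u)"
      by (rule integral_complex_of_real)
    also have "(LBINT u. F u) = real n * h"
      unfolding F_def integral_shift_sum[OF int(1)] int(2) ..
    finally show ?thesis .
  qed
  ultimately show ?thesis
    by (simp add: is_projection_def)
qed

end
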